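(* For every integer $N\ge 2$, there exists an Ulam polynomial of degree either $N$ or $N-1$ with all coefficients different from zero.
   Context: An Ulam polynomial of degree $d\ge 1$ is a monic polynomial $x^d+\sum_{m=1}^d\gamma_mx^{d-m}$ with complex coefficients such that $x^d+\sum_{m=1}^d\gamma_mx^{d-m}=\prod_{n=1}^d(x-\gamma_n)$, i.e. its (non-leading) coefficients coincide with its zeros, counted with multiplicity. "All coefficients different from zero" means $\gamma_m\neq0$ for all $m=1,\dots,d$. *)

theory Defs
  imports Complex_Main "HOL-Computational_Algebra.Polynomial"
begin

definition ulam_polynomial :: "nat \<Rightarrow> complex poly \<Rightarrow> bool" where
  "ulam_polynomial d p \<longleftrightarrow> d \<ge> 1 \<and>
     (\<exists>\<gamma> :: nat \<Rightarrow> complex.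
        p = monom 1 d + (\<Sum>m=1..d. monom (\<gamma> m) (d - m)) \<and>
        p = (\<Prod>n=1..d. [:- \<gamma> n, 1:]))"

lemma ulam_polynomial_degree:
  assumes "ulam_polynomial d p"
  shows "degree p = d"
proof -
  obtain \<gamma> :: "nat \<Rightarrow> complex" where p: "p = (\<Prod>n=1..d. [:- \<gamma> n, 1:])"
    using assms by (auto simp: ulam_polynomial_def)
  have "degree p = (\<Sum>n=1..d. degree [:- \<gamma> n, 1:])"
    unfolding p by (rule degree_prod_eq_sum_degree) auto
  then show ?thesis by simp
qed

end

(*
  Number coefficients and roots from 0. Dividing x^N + a_0 x^(N-1) + ... + a_(N-1) successively by
  x - a_0, ..., x - a_(N-1) gives remainders f_0, ..., f_(N-1) in C[a_0, ..., a_(N-1)] whose common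
  zeros are the Ulam polynomials of degree N. If a_k has weight k + 2, the part of f_k of highest
  weight is a nonzero multiple of the pure power a_k^(N-k). These powers are pairwise coprime, so by
  the Koszul argument behind Buchberger's criterion the monomials in which each a_k has exponent
  below N - k form a basis of the quotient by I = (f_0, ..., f_(N-1)). In particular a_(N-1), which is congruent
  to -(2 a_0 + a_1 + ... + a_(N-2)) modulo I, is not in I, so the ideal quotient (I : a_(N-1)) is
  proper and has a zero. It contains 1 + (-a_0)...(-a_(N-2)), because a_(N-1) is congruent to
  (-a_0)...(-a_(N-1)) modulo I. At the zero, a_0, ..., a_(N-2) are therefore nonzero: if a_(N-1) is
  nonzero as well the degree is N, and otherwise dropping a factor x leaves degree N - 1.
*)
theory Submission
  imports
    Defs
    "HOL-Library.Poly_Mapping"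
    "HOL-Computational_Algebra.Fundamental_Theorem_Algebra"
begin

section \<open>Monomials and weights\<close>

type_synonym mpoly = "(nat \<Rightarrow>\<^sub>0 nat) \<Rightarrow>\<^sub>0 complex"

abbreviation lookup where "lookup \<equiv> Poly_Mapping.lookup"
abbreviation keys where "keys \<equiv> Poly_Mapping.keys"
abbreviation single where "single \<equiv> Poly_Mapping.single"

abbreviation mon :: "(nat \<Rightarrow>\<^sub>0 nat) \<Rightarrow> mpoly" where
  "mon m \<equiv> single m 1"

abbreviation const :: "complex \<Rightarrow> mpoly" where
  "const c \<equiv> single 0 c"

abbreviation var :: "nat \<Rightarrow> mpoly" where
  "var i \<equiv> mon (single i 1)"

text \<open>Makes spans and linear dependence over the complex numbers available for
  polynomials.\<close>

interpretation vs: vector_space "\<lambda>c (p :: mpoly). const c * p"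
  by unfold_locales (simp_all add: distrib_left distrib_right single_add mult_single flip: mult.assoc)

lemma sum_monomials: "(\<Sum>m\<in>keys p. const (lookup p m) * mon m) = (p :: mpoly)"
proof (rule poly_mapping_eqI)
  fix n
  have "lookup (\<Sum>m\<in>keys p. const (lookup p m) * mon m) n
      = (\<Sum>m\<in>keys p. if m = n then lookup p m else 0)"
    by (simp add: lookup_sum mult_single lookup_single when_def)
  also have "\<dots> = lookup p n"
    by (auto simp: in_keys_iff)
  finally show "lookup (\<Sum>m\<in>keys p. const (lookup p m) * mon m) n = lookup p n" .
qed

lemma mult_in_spanI:
  assumes "\<And>m. m \<in> keys p \<Longrightarrow> mon m * q \<in> vs.span S"
  shows "p * q \<in> vs.span S"
proof -
  have "p * q = (\<Sum>m\<in>keys p. const (lookup p m) * (mon m * q))"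
    by (subst sum_monomials[symmetric, of p]) (simp add: sum_distrib_right mult.assoc)
  also have "\<dots> \<in> vs.span S"
    using assms by (intro vs.span_sum vs.span_scale)
  finally show ?thesis .
qed

lemma lookup_const_mult: "lookup (const c * p) n = c * lookup p n"
  unfolding mult_map_scale_conv_mult[symmetric] by (simp add: Poly_Mapping.map.rep_eq when_def)

lemma keys_mon_mult: "keys (mon m * p) \<subseteq> (+) m ` keys p"
  using keys_mult[of "mon m" p] by auto

lemma lookup_mon_mult: "lookup (mon m * p) (m + n) = lookup p n"
proof -
  \<comment> \<open>Adding \<open>m\<close> is injective, so deleting the term at \<open>n\<close>
    from \<open>p\<close> leaves nothing at \<open>m + n\<close> in the product.\<close>
  let ?r = "p - single n (lookup p n)"
  have "n \<notin> keys ?r"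
    by (simp add: in_keys_iff lookup_minus)
  then have "m + n \<notin> keys (mon m * ?r)"
    using keys_mon_mult[of m ?r] by auto
  then have "lookup (mon m * ?r) (m + n) = 0"
    by (simp add: in_keys_iff)
  then show ?thesis
    by (simp add: right_diff_distrib lookup_minus mult_single)
qed

section \<open>Weights and leading monomials\<close>

definition weight :: "(nat \<Rightarrow> nat) \<Rightarrow> (nat \<Rightarrow>\<^sub>0 nat) \<Rightarrow> nat" where
  "weight w m = (\<Sum>i\<in>keys m. w i * lookup m i)"

lemma weight_superset:
  assumes "finite A" "keys m \<subseteq> A"
  shows "weight w m = (\<Sum>i\<in>A. w i * lookup m i)"
  unfolding weight_def using assms
  by (intro sum.mono_neutral_left) (auto simp: in_keys_iff)

lemma weight_add [simp]: "weight w (m + n) = weight w m + weight w n"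
proof -
  let ?A = "keys m \<union> keys n"
  have "keys (m + n) \<subseteq> ?A" by (rule keys_add)
  then have "weight w (m + n) = (\<Sum>i\<in>?A. w i * lookup (m + n) i)"
    by (intro weight_superset) auto
  also have "\<dots> = (\<Sum>i\<in>?A. w i * lookup m i) + (\<Sum>i\<in>?A. w i * lookup n i)"
    by (simp add: lookup_add algebra_simps sum.distrib)
  also have "\<dots> = weight w m + weight w n"
    by (simp add: weight_superset[of ?A])
  finally show ?thesis .
qed

lemma weight_single [simp]: "weight w (single k i) = w k * i"
  by (simp add: weight_def)

lemma monomial_factor:
  fixes m :: "nat \<Rightarrow>\<^sub>0 nat"
  assumes "a \<le> lookup m k"
  obtains m' where "m = m' + single k a"
proof
  show "m = (m - single k a) + single k a"
    using assms by (intro poly_mapping_eqI) (auto simp: lookup_add lookup_minus lookup_single when_def)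
qed

text \<open>Distinct monomials can share a weight, so uniqueness of the heaviest one is part of the
  notion.\<close>

definition leads :: "(nat \<Rightarrow> nat) \<Rightarrow> (nat \<Rightarrow>\<^sub>0 nat) \<Rightarrow> mpoly \<Rightarrow> bool" where
  "leads w m p \<longleftrightarrow> lookup p m \<noteq> 0 \<and> (\<forall>n\<in>keys p. n \<noteq> m \<longrightarrow> weight w n < weight w m)"

lemma leads_weight_le:
  assumes "leads w m p" "n \<in> keys p"
  shows "weight w n \<le> weight w m"
  using assms by (cases "n = m") (auto simp: leads_def dest: less_imp_le)

lemma leads_add:
  assumes "leads w m p" "\<And>n. n \<in> keys r \<Longrightarrow> weight w n < weight w m"
  shows "leads w m (r + p)"
proof -
  have "lookup r m = 0"
    using assms(2) by (auto simp: in_keys_iff)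
  then show ?thesis
    using assms keys_add[of r p] by (auto simp: leads_def lookup_add)
qed

lemma leads_mon_mult:
  assumes "leads w m p"
  shows "leads w (n + m) (mon n * p)"
  using assms keys_mon_mult[of n p] by (fastforce simp: leads_def lookup_mon_mult)

section \<open>Generators with coprime leading monomials\<close>

text \<open>Powers of distinct variables are pairwise coprime, which is what Buchberger's
  coprimality criterion asks of leading monomials.\<close>

locale pure_powers =
  fixes w d :: "nat \<Rightarrow> nat" and f :: "nat \<Rightarrow> mpoly"
  assumes leads_f: "leads w (single k (d k)) (f k)"
begin

definition lc :: "nat \<Rightarrow> complex" where
  "lc k = lookup (f k) (single k (d k))"

definition tail :: "nat \<Rightarrow> mpoly" where
  "tail k = f k - single (single k (d k)) (lc k)"

text \<open>The ideal generated by the \<open>f k\<close>, written as a linear span so that its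
  spanning set can be thinned out to \<open>std\<close>.\<close>

definition I :: "mpoly set" where
  "I = vs.span (range (\<lambda>(m, k). mon m * f k))"

definition reduced :: "(nat \<Rightarrow>\<^sub>0 nat) set" where
  "reduced = {m. \<forall>k. lookup m k < d k}"

text \<open>In such a pair, \<open>k\<close> is the least index whose leading power divides
  \<open>m + single k (d k)\<close>. So each non-reduced monomial leads \<open>mon m * f k\<close>
  for exactly one pair.\<close>

definition std :: "((nat \<Rightarrow>\<^sub>0 nat) \<times> nat) set" where
  "std = {(m, k). \<forall>j<k. lookup m j < d j}"

lemma lc_nonzero: "lc k \<noteq> 0"
  using leads_f by (simp add: lc_def leads_def)

lemma weight_tail:
  assumes "n \<in> keys (tail k)"
  shows "weight w n < w k * d k"
proof -
  have "n \<noteq> single k (d k)"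
    using assms by (auto simp: in_keys_iff tail_def lc_def lookup_minus)
  moreover from this have "n \<in> keys (f k)"
    using assms by (auto simp: in_keys_iff tail_def lookup_minus lookup_single when_def)
  ultimately show ?thesis
    using leads_f[of k] by (auto simp: leads_def)
qed

lemma weight_f: "n \<in> keys (f k) \<Longrightarrow> weight w n \<le> w k * d k"
  using leads_weight_le[OF leads_f] by fastforce

lemma mon_reduce:
  "mon (m + single k (d k)) = const (1 / lc k) * (mon m * f k - mon m * tail k)"
proof -
  have "mon m * f k - mon m * tail k = mon m * single (single k (d k)) (lc k)"
    by (simp add: tail_def algebra_simps)
  then show ?thesis
    using lc_nonzero[of k] by (simp add: mult_single)
qed

lemma mult_f_in_I: "p * f k \<in> I"
  unfolding I_def
  by (rule mult_in_spanI, rule vs.span_base) (force intro: range_eqI[of _ _ "(_, k)"])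

lemma f_in_I: "f k \<in> I"
  using mult_f_in_I[of 1 k] by simp

lemma I_add: "p \<in> I \<Longrightarrow> q \<in> I \<Longrightarrow> p + q \<in> I"
  unfolding I_def by (rule vs.span_add)

lemma I_mult:
  assumes "p \<in> I"
  shows "r * p \<in> I"
  using assms unfolding I_def
proof (induction p rule: vs.span_induct_alt)
  case base
  show ?case by (simp add: vs.span_zero)
next
  case (step c x y)
  obtain m k where x: "x = mon m * f k"
    using step(1) by auto
  have "r * (const c * x) \<in> I"
    using mult_f_in_I[of "r * const c * mon m" k] by (simp only: x mult.assoc)
  moreover have "r * y \<in> I"
    using step(2) by (simp only: I_def)
  ultimately show ?case
    by (simp only: distrib_left I_add I_def[symmetric])
qed

text \<open>
  If \<open>mon m\<close> is divisible by the leading power of some \<open>f j\<close> with \<open>j < k\<close>, then the Koszul relation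
  between \<open>f j\<close> and \<open>f k\<close> trades \<open>mon m * f k\<close> for multiples of \<open>f j\<close> of no larger weight and
  multiples of \<open>f k\<close> of smaller weight.
\<close>
lemma mon_mult_f_in_span_std:
  "mon m * f k \<in> vs.span ((\<lambda>(m, k). mon m * f k) ` std)" (is "_ \<in> vs.span ?G")
\<comment> \<open>The order is lexicographic: first the weight of the leading monomial of
  \<open>mon m * f k\<close>, then \<open>k\<close>. Multiples of \<open>f j\<close> may keep the
  weight, but \<open>j < k\<close>.\<close>
proof (induction "(m, k)" arbitrary: m k
    rule: wf_induct_rule[OF wf_measures[of "[\<lambda>(m, k). weight w m + w k * d k, snd]"]])
  case 1
  then have IH: "mon n * f j \<in> vs.span ?G"
    if "weight w n + w j * d j < weight w m + w k * d k \<or>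
        weight w n + w j * d j = weight w m + w k * d k \<and> j < k" for n j
    using that by auto
  show ?case
  proof (cases "(m, k) \<in> std")
    case True
    then show ?thesis by (intro vs.span_base image_eqI[of _ _ "(m, k)"]) simp_all
  next
    case False
    then obtain j where j: "j < k" "d j \<le> lookup m j"
      by (auto simp: std_def not_less)
    then obtain m' where m': "m = m' + single j (d j)"
      using monomial_factor by metis
    have "mon n * f j \<in> vs.span ?G" if n: "n \<in> keys (mon m' * f k)" for n
    proof -
      obtain n' where n': "n' \<in> keys (f k)" "n = m' + n'"
        using keys_mon_mult[of m' "f k"] n by auto
      show ?thesis
        using weight_f[OF n'(1)] j(1) by (intro IH) (auto simp: n' m')
    qed
    then have A: "mon m' * f k * f j \<in> vs.span ?G"
      by (rule mult_in_spanI)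
    have "mon n * f k \<in> vs.span ?G" if n: "n \<in> keys (mon m' * tail j)" for n
    proof -
      obtain n' where n': "n' \<in> keys (tail j)" "n = m' + n'"
        using keys_mon_mult[of m' "tail j"] n by auto
      show ?thesis
        using weight_tail[OF n'(1)] by (intro IH) (auto simp: n' m')
    qed
    then have B: "mon m' * tail j * f k \<in> vs.span ?G"
      by (rule mult_in_spanI)
    have "mon m * f k = const (1 / lc j) * (mon m' * f k * f j - mon m' * tail j * f k)"
      unfolding m' mon_reduce by (simp add: algebra_simps)
    then show ?thesis
      using A B by (simp only: vs.span_scale vs.span_diff)
  qed
qed

lemma I_eq_span_std: "I = vs.span ((\<lambda>(m, k). mon m * f k) ` std)"
proof
  show "I \<subseteq> vs.span ((\<lambda>(m, k). mon m * f k) ` std)"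
    unfolding I_def by (intro vs.span_minimal) (auto simp: mon_mult_f_in_span_std)
  show "vs.span ((\<lambda>(m, k). mon m * f k) ` std) \<subseteq> I"
    unfolding I_def by (intro vs.span_mono) auto
qed

lemma inj_on_std: "inj_on (\<lambda>(m, k). m + single k (d k)) std"
proof (rule inj_onI, clarify)
  fix m k n l
  assume std: "(m, k) \<in> std" "(n, l) \<in> std" and eq: "m + single k (d k) = n + single l (d l)"
  have lookup_eq: "lookup m i + (d k when k = i) = lookup n i + (d l when l = i)" for i
    using arg_cong[OF eq, of "\<lambda>p. lookup p i"] by (simp add: lookup_add lookup_single)
  \<comment> \<open>At the smaller index one side has exponent at least \<open>d\<close>, the other,
    by \<open>std\<close>, an exponent below it.\<close>
  have "\<not> k < l"
    using lookup_eq[of k] std(2) by (auto simp: std_def)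
  moreover have "\<not> l < k"
    using lookup_eq[of l] std(1) by (auto simp: std_def)
  ultimately have "k = l" by simp
  then show "m = n \<and> k = l" using eq by simp
qed

text \<open>In a combination of the \<open>std\<close> generators the leading monomials are
  distinct, so one of maximal weight cannot cancel, and it is not reduced. Hence reduced monomials
  are independent modulo \<open>I\<close>.\<close>

lemma keys_not_subset_reduced:
  assumes "p \<in> I" "p \<noteq> 0"
  shows "\<not> keys p \<subseteq> reduced"
proof -
  let ?G = "\<lambda>(m, k). mon m * f k" and ?\<mu> = "\<lambda>(m, k). m + single k (d k)"
  from assms(1) obtain t u where t: "finite t" "t \<subseteq> ?G ` std" "p = (\<Sum>a\<in>t. const (u a) * a)"
    unfolding I_eq_span_std vs.span_explicit by blast
  \<comment> \<open>One pair is chosen per product, so that the sum can be indexed by pairs.\<close>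
  obtain T where T: "T \<subseteq> std" "inj_on ?G T" "t = ?G ` T"
    using t(2) by (auto simp: subset_image_inj)
  then have "finite T"
    using t(1) by (auto dest: finite_imageD)
  have p: "p = (\<Sum>x\<in>T. const (u (?G x)) * ?G x)"
    by (simp add: t(3) T(3) sum.reindex[OF T(2)])
  define T' where "T' = {x\<in>T. u (?G x) \<noteq> 0}"
  have p': "p = (\<Sum>x\<in>T'. const (u (?G x)) * ?G x)"
    unfolding p T'_def using \<open>finite T\<close> by (intro sum.mono_neutral_right) auto
  have "T' \<noteq> {}" using p' assms(2) by auto
  moreover have fin: "finite T'" using \<open>finite T\<close> by (simp add: T'_def)
  ultimately have "Max ((\<lambda>y. weight w (?\<mu> y)) ` T') \<in> (\<lambda>y. weight w (?\<mu> y)) ` T'"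
    by (intro Max_in) auto
  then obtain x where x: "x \<in> T'"
    and x_Max: "weight w (?\<mu> x) = Max ((\<lambda>y. weight w (?\<mu> y)) ` T')"
    by force
  have max: "weight w (?\<mu> y) \<le> weight w (?\<mu> x)" if "y \<in> T'" for y
    unfolding x_Max using fin that by (intro Max_ge) auto
  have lead: "leads w (?\<mu> y) (?G y)" for y
    using leads_mon_mult[OF leads_f[of "snd y"], of "fst y"] by (simp add: case_prod_unfold)
  have zero: "lookup (?G y) (?\<mu> x) = 0" if y: "y \<in> T'" "y \<noteq> x" for y
  proof (rule ccontr)
    assume "lookup (?G y) (?\<mu> x) \<noteq> 0"
    then have "?\<mu> x \<in> keys (?G y)" by (simp add: in_keys_iff)
    moreover have "?\<mu> x \<noteq> ?\<mu> y"
      using inj_onD[OF inj_on_std, of x y] x y T(1) by (auto simp: T'_def)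
    ultimately have "weight w (?\<mu> x) < weight w (?\<mu> y)"
      using lead[of y] unfolding leads_def by blast
    then show False using max[OF y(1)] by simp
  qed
  have "lookup p (?\<mu> x) = (\<Sum>y\<in>T'. u (?G y) * lookup (?G y) (?\<mu> x))"
    by (simp add: p' lookup_sum lookup_const_mult)
  also have "\<dots> = u (?G x) * lookup (?G x) (?\<mu> x)"
    using zero by (simp add: sum.remove[OF fin x])
  also have "\<dots> \<noteq> 0"
    using lead[of x] x by (auto simp: leads_def T'_def)
  finally have "?\<mu> x \<in> keys p" by (simp add: in_keys_iff)
  moreover have "?\<mu> x \<notin> reduced"
    by (auto simp: reduced_def case_prod_unfold lookup_add not_less intro!: exI[of _ "snd x"])
  ultimately show ?thesis by blast
qed

text \<open>Modulo \<open>I\<close>, a leading power can be replaced by a multiple of its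
  \<open>tail\<close>, which lowers the weight.\<close>

lemma mon_in_span: "mon m \<in> vs.span (mon ` reduced \<union> I)"
proof (induction m rule: measure_induct_rule[of "weight w"])
  case (less m)
  show ?case
  proof (cases "m \<in> reduced")
    case True
    then show ?thesis by (intro vs.span_base) auto
  next
    case False
    then obtain k where "d k \<le> lookup m k" by (auto simp: reduced_def not_less)
    then obtain m' where m': "m = m' + single k (d k)"
      using monomial_factor by metis
    have "mon n * 1 \<in> vs.span (mon ` reduced \<union> I)" if n: "n \<in> keys (mon m' * tail k)" for n
    proof -
      obtain n' where n': "n' \<in> keys (tail k)" "n = m' + n'"
        using keys_mon_mult[of m' "tail k"] n by auto
      show ?thesis
        using less[of n] weight_tail[OF n'(1)] by (simp add: n' m')
    qed
    then have "mon m' * tail k * 1 \<in> vs.span (mon ` reduced \<union> I)"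
      by (rule mult_in_spanI)
    moreover have "mon m' * f k \<in> vs.span (mon ` reduced \<union> I)"
      by (intro vs.span_base) (simp add: mult_f_in_I)
    ultimately show ?thesis
      unfolding m' mon_reduce by (intro vs.span_scale vs.span_diff) simp_all
  qed
qed

lemma in_span_reduced: "p \<in> vs.span (mon ` reduced \<union> I)"
  using mult_in_spanI[of p 1] mon_in_span by simp

text \<open>An exponent below 1 is 0, so only the first \<open>n\<close> variables occur, with
  bounded exponents.\<close>

lemma finite_reduced:
  assumes "\<And>k. k \<ge> n \<Longrightarrow> d k = 1"
  shows "finite reduced"
proof -
  have "lookup ` reduced \<subseteq> {g. \<forall>k. (k \<in> {..<n} \<longrightarrow> g k \<in> {..Max (d ` {..<n})}) \<and> (k \<notin> {..<n} \<longrightarrow> g k = 0)}"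
  proof clarsimp
    fix m k assume m: "m \<in> reduced"
    then have "lookup m k < d k" by (simp add: reduced_def)
    moreover have "d k \<le> Max (d ` {..<n})" if "k < n" using that by (intro Max_ge) auto
    then have "lookup m k \<le> Max (d ` {..<n})" if "k < n"
      using that calculation by (meson less_imp_le le_trans)
    ultimately show "(k < n \<longrightarrow> lookup m k \<le> Max (d ` {..<n})) \<and> (\<not> k < n \<longrightarrow> lookup m k = 0)"
      using assms[of k] by (cases "k < n") simp_all
  qed
  moreover have "finite {g :: nat \<Rightarrow> nat. \<forall>k. (k \<in> {..<n} \<longrightarrow> g k \<in> {..Max (d ` {..<n})}) \<and> (k \<notin> {..<n} \<longrightarrow> g k = 0)}"
    by (rule finite_set_of_finite_funs) auto
  ultimately have "finite (lookup ` reduced)" by (rule finite_subset)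
  then show ?thesis
    by (rule finite_imageD) (auto intro!: inj_onI poly_mapping_eqI)
qed

end

section \<open>Common zeros of a proper ideal of finite codimension\<close>

definition is_ideal :: "mpoly set \<Rightarrow> bool" where
  "is_ideal J \<longleftrightarrow> 0 \<in> J \<and> (\<forall>p\<in>J. \<forall>q\<in>J. p + q \<in> J) \<and> (\<forall>r. \<forall>p\<in>J. r * p \<in> J)"

lemma ideal_add: "is_ideal J \<Longrightarrow> p \<in> J \<Longrightarrow> q \<in> J \<Longrightarrow> p + q \<in> J"
  and ideal_mult: "is_ideal J \<Longrightarrow> p \<in> J \<Longrightarrow> r * p \<in> J"
  and ideal_zero: "is_ideal J \<Longrightarrow> 0 \<in> J"
  by (simp_all add: is_ideal_def)

lemma ideal_diff: "is_ideal J \<Longrightarrow> p \<in> J \<Longrightarrow> q \<in> J \<Longrightarrow> p - q \<in> J"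
  using ideal_add[of J p "- q"] ideal_mult[of J q "-1"] by simp

lemma ideal_subspace: "is_ideal J \<Longrightarrow> vs.subspace J"
  by (simp add: vs.subspace_def is_ideal_def)

lemma const_in_ideal_imp_zero:
  assumes "is_ideal J" "1 \<notin> J" "const c \<in> J"
  shows "c = 0"
proof (rule ccontr)
  assume "c \<noteq> 0"
  then have "const (inverse c) * const c = 1"
    by (simp add: mult_single)
  then show False
    using ideal_mult[OF assms(1,3), of "const (inverse c)"] assms(2) by simp
qed

text \<open>The set is the ideal generated by \<open>J\<close> and \<open>y\<close>.\<close>

lemma is_ideal_adjoin:
  assumes "is_ideal J"
  shows "is_ideal {j + r * y | j r. j \<in> J}"
proof -
  have "\<exists>j r. 0 = j + r * y \<and> j \<in> J"
    using ideal_zero[OF assms] by (intro exI[of _ 0]) auto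
  moreover have "\<exists>j' r'. (j1 + r1 * y) + (j2 + r2 * y) = j' + r' * y \<and> j' \<in> J"
    if "j1 \<in> J" "j2 \<in> J" for j1 j2 r1 r2
    using ideal_add[OF assms that]
    by (intro exI[of _ "j1 + j2"] exI[of _ "r1 + r2"]) (simp add: algebra_simps)
  moreover have "\<exists>j' r'. s * (j + r * y) = j' + r' * y \<and> j' \<in> J" if "j \<in> J" for s j r
    using ideal_mult[OF assms that, of s]
    by (intro exI[of _ "s * j"] exI[of _ "s * r"]) (simp add: algebra_simps)
  ultimately show ?thesis
    unfolding is_ideal_def by blast
qed

section \<open>Univariate relations modulo an ideal and the choice of a point\<close>

definition subst :: "complex poly \<Rightarrow> mpoly \<Rightarrow> mpoly" where
  "subst q x = poly (map_poly (single 0) q) x"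

lemma subst_pCons: "subst (pCons c q) x = const c + x * subst q x"
  by (simp add: subst_def map_poly_pCons)

lemma subst_diff_smult: "subst (p - smult a q) x = subst p x - const a * subst q x"
proof (induction p q rule: poly_induct2)
  case 0
  show ?case by (simp add: subst_def)
next
  case (pCons b p c q)
  have "subst (pCons b p - smult a (pCons c q)) x = const (b - a * c) + x * subst (p - smult a q) x"
    by (simp add: subst_pCons)
  also have "\<dots> = const b + x * subst p x - const a * (const c + x * subst q x)"
    unfolding pCons by (simp add: single_diff mult_single algebra_simps)
  finally show ?case by (simp only: subst_pCons)
qed

lemma subst_sum_monom:
  "subst (\<Sum>j\<le>n. monom (c j) j) x = (\<Sum>j\<le>n. const (c j) * x ^ j)"
proof (induction n arbitrary: c)
  case 0
  show ?case by (simp add: monom_0 subst_pCons) (simp add: subst_def)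
next
  case (Suc n)
  have "(\<Sum>j\<le>Suc n. monom (c j) j) = pCons (c 0) (\<Sum>j\<le>n. monom (c (Suc j)) j)"
    by (intro poly_eqI) (auto simp: coeff_sum coeff_pCons split: nat.splits)
  then show ?case
    using Suc[of "\<lambda>j. c (Suc j)"]
    by (simp add: subst_pCons sum.atMost_Suc_shift sum_distrib_left mult.left_commute
        del: sum.atMost_Suc)
qed

lemma subst_root_factor: "subst ([:- a, 1:] * s) x = (x - const a) * subst s x"
proof -
  have "[:- a, 1:] * s = pCons 0 s - smult a s"
    by simp
  then show ?thesis
    by (simp only: subst_diff_smult subst_pCons) (simp add: algebra_simps)
qed

text \<open>Take a root \<open>a\<close> of \<open>q\<close>. If \<open>x - const a\<close> is a
  unit modulo \<open>J\<close>, its factor can be cancelled from \<open>q\<close>; this must stop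
  before a nonzero constant lands in \<open>J\<close>.\<close>

lemma proper_adjoin_root:
  assumes "is_ideal J" "1 \<notin> J" "subst q x \<in> J" "q \<noteq> 0"
  obtains a where "1 \<notin> {j + r * (x - const a) | j r. j \<in> J}"
  using assms(3,4)
proof (induction "degree q" arbitrary: q thesis)
  case 0
  then obtain c where "q = [:c:]" by (auto elim: degree_eq_zeroE)
  then have "c = 0"
    using 0 const_in_ideal_imp_zero[OF assms(1,2), of c] by (simp add: subst_def map_poly_pCons)
  then show ?case using 0 \<open>q = [:c:]\<close> by simp
next
  case (Suc n)
  obtain a where "poly q a = 0"
    using Suc.hyps(2) by (metis fundamental_theorem_of_algebra constant_degree nat.distinct(1))
  then obtain s where s: "q = [:- a, 1:] * s"
    unfolding poly_eq_0_iff_dvd by (elim dvdE)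
  show ?case
  proof (cases "1 \<in> {j + r * (x - const a) | j r. j \<in> J}")
    case True
    then obtain j r where j: "1 = j + r * (x - const a)" "j \<in> J" by auto
    \<comment> \<open>Multiplying by the inverse \<open>r\<close> of \<open>x - const a\<close>
      modulo \<open>J\<close> turns \<open>subst q x\<close> into \<open>subst s x\<close>.\<close>
    have "subst s x = (j + r * (x - const a)) * subst s x"
      unfolding j(1)[symmetric] by simp
    also have "\<dots> = subst s x * j + r * subst q x"
      unfolding s subst_root_factor by (simp only: algebra_simps)
    also have "\<dots> \<in> J"
      using j(2) Suc.prems(2) assms(1) by (intro ideal_add ideal_mult)
    finally have "subst s x \<in> J" .
    moreover have "s \<noteq> 0" using Suc.prems(3) s by auto
    moreover have "degree q = Suc (degree s)"
      using \<open>s \<noteq> 0\<close> unfolding s by (subst degree_mult_eq) auto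
    ultimately show ?thesis
      using Suc.hyps Suc.prems(1) by auto
  next
    case False
    then show ?thesis using Suc.prems(1) by blast
  qed
qed

lemma linear_relation:
  assumes "finite B" "\<And>j. j \<le> card B \<Longrightarrow> b j \<in> vs.span B"
  obtains c i where "i \<le> card B" "c i \<noteq> 0" "(\<Sum>j\<le>card B. const (c j) * b j) = 0"
\<comment> \<open>Dependence is a property of sets, so a repeated vector needs its own relation,
  with coefficients 1 and -1.\<close>
proof (cases "inj_on b {..card B}")
  case False
  then obtain i j where ij: "i \<le> card B" "j \<le> card B" "i \<noteq> j" "b i = b j"
    by (auto simp: inj_on_def)
  define c :: "nat \<Rightarrow> complex" where "c k = (if k = i then 1 else if k = j then -1 else 0)" for k
  have "(\<Sum>k\<le>card B. const (c k) * b k) = (\<Sum>k\<in>{i, j}. const (c k) * b k)"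
    using ij by (intro sum.mono_neutral_right) (auto simp: c_def)
  also have "\<dots> = 0"
    using ij by (simp add: c_def single_uminus)
  finally show ?thesis
    using ij that[of i c] by (simp add: c_def)
next
  case True
  have "vs.dependent (b ` {..card B})"
  proof (rule ccontr)
    assume "\<not> vs.dependent (b ` {..card B})"
    then have "card (b ` {..card B}) \<le> card B"
      using vs.independent_span_bound[OF assms(1)] assms(2) by blast
    then show False by (simp add: card_image[OF True])
  qed
  then obtain u v where "v \<in> b ` {..card B}" "u v \<noteq> 0"
      "(\<Sum>v\<in>b ` {..card B}. const (u v) * v) = 0"
    by (subst (asm) vs.dependent_finite) auto
  then show ?thesis
    using that[of _ "\<lambda>j. u (b j)"] by (auto simp: sum.reindex[OF True])
qed

text \<open>The quotient by \<open>J\<close> is finite-dimensional, so the powers of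
  \<open>x\<close> are dependent modulo \<open>J\<close>; a suitable root of the resulting
  univariate polynomial serves as the value of \<open>x\<close>.\<close>

lemma adjoin_value:
  assumes J: "is_ideal J" "1 \<notin> J" and B: "finite B" "\<And>p. p \<in> vs.span (B \<union> J)"
  obtains a J' where "is_ideal J'" "1 \<notin> J'" "J \<subseteq> J'" "x - const a \<in> J'"
proof -
  have "\<exists>b\<in>vs.span B. x ^ j - b \<in> J" for j
  proof -
    obtain b y where "x ^ j = b + y" "b \<in> vs.span B" "y \<in> vs.span J"
      using B(2)[of "x ^ j"] unfolding vs.span_Un by auto
    moreover have "vs.span J = J"
      using ideal_subspace[OF J(1)] by simp
    ultimately show ?thesis by (intro bexI[of _ b]) auto
  qed
  then obtain b where b: "\<And>j. b j \<in> vs.span B" "\<And>j. x ^ j - b j \<in> J"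
    by metis
  obtain c i where c: "i \<le> card B" "c i \<noteq> 0" "(\<Sum>j\<le>card B. const (c j) * b j) = 0"
    by (rule linear_relation[OF B(1) b(1)])
  define q where "q = (\<Sum>j\<le>card B. monom (c j) j)"
  have "coeff q i = c i"
    using c(1) by (simp add: q_def coeff_sum)
  then have "q \<noteq> 0" using c(2) by auto
  have "subst q x = (\<Sum>j\<le>card B. const (c j) * (x ^ j - b j))"
    unfolding q_def subst_sum_monom using c(3) by (simp add: right_diff_distrib sum_subtractf)
  also have "\<dots> \<in> J"
    by (rule vs.subspace_sum[OF ideal_subspace[OF J(1)]]) (rule ideal_mult[OF J(1) b(2)])
  finally obtain a where a: "1 \<notin> {j + r * (x - const a) | j r. j \<in> J}"
    by (rule proper_adjoin_root[OF J _ \<open>q \<noteq> 0\<close>])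
  show thesis
  proof (rule that[OF is_ideal_adjoin[OF J(1)] a])
    show "J \<subseteq> {j + r * (x - const a) | j r. j \<in> J}"
    proof
      fix p assume "p \<in> J"
      then show "p \<in> {j + r * (x - const a) | j r. j \<in> J}"
        by (intro CollectI exI[of _ p] exI[of _ 0]) simp
    qed
    show "x - const a \<in> {j + r * (x - const a) | j r. j \<in> J}"
      using ideal_zero[OF J(1)] by (intro CollectI exI[of _ 0] exI[of _ 1]) simp
  qed
qed

text \<open>A weak Nullstellensatz in finite codimension: the variables receive their values one at
  a time while the ideal stays proper.\<close>

lemma proper_ideal_point:
  assumes "is_ideal J" "1 \<notin> J" "finite B" "\<And>p. p \<in> vs.span (B \<union> J)"
  shows "\<exists>a J'. is_ideal J' \<and> 1 \<notin> J' \<and> J \<subseteq> J' \<and> (\<forall>i<n. var i - const (a i) \<in> J')"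
proof (induction n)
  case 0
  show ?case using assms by blast
next
  case (Suc n)
  then obtain a J' where J': "is_ideal J'" "1 \<notin> J'" "J \<subseteq> J'" "\<forall>i<n. var i - const (a i) \<in> J'"
    by blast
  have "p \<in> vs.span (B \<union> J')" for p
    using assms(4)[of p] vs.span_mono[of "B \<union> J" "B \<union> J'"] J'(3) by blast
  then obtain c J'' where J'': "is_ideal J''" "1 \<notin> J''" "J' \<subseteq> J''" "var n - const c \<in> J''"
    by (rule adjoin_value[OF J'(1,2) assms(3)])
  have "\<forall>i<Suc n. var i - const ((a(n := c)) i) \<in> J''"
    using J'(4) J''(3,4) by (auto simp: less_Suc_eq)
  then show ?case
    using J'(3) J'' by (meson subset_trans)
qed

section \<open>Synthetic division by the roots\<close>

text \<open>
  As generating functions, \<open>(\<Sum>i. synth x k i * t^i) = (1 + (\<Sum>i. x i * t^(i + 1))) / (\<Prod>j<k. 1 - x j * t)\<close>.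
  With \<open>t = 1 / X\<close> this is the successive division of \<open>X^n + x 0 * X^(n - 1) + \<dots> + x (n - 1)\<close> by
  \<open>X - x 0\<close>, \<open>X - x 1\<close>, and so on, and \<open>synth x (k + 1) (n - k)\<close> is the remainder at the \<open>k\<close>-th step.
\<close>
fun synth :: "(nat \<Rightarrow> 'a::comm_ring_1) \<Rightarrow> nat \<Rightarrow> nat \<Rightarrow> 'a" where
  "synth x k 0 = 1"
| "synth x 0 (Suc i) = x i"
| "synth x (Suc k) (Suc i) = synth x k (Suc i) + x k * synth x (Suc k) i"

text \<open>The degree-\<open>n\<close> quotient after \<open>k\<close> divisions, with
  \<open>synth a k i\<close> as coefficient of \<open>X^(n - i)\<close>.\<close>

fun synth_poly :: "(nat \<Rightarrow> complex) \<Rightarrow> nat \<Rightarrow> nat \<Rightarrow> complex poly" where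
  "synth_poly a k 0 = 1"
| "synth_poly a k (Suc n) = pCons (synth a k (Suc n)) (synth_poly a k n)"

text \<open>The recursion of \<open>synth\<close> is Horner's scheme for division by
  \<open>X - a k\<close>.\<close>

lemma synth_poly_division:
  "synth_poly a k (Suc n) = [:- a k, 1:] * synth_poly a (Suc k) n + [:synth a (Suc k) (Suc n):]"
proof (induction n)
  case 0
  show ?case by (simp add: one_pCons)
next
  case (Suc n)
  have "synth_poly a k (Suc (Suc n))
      = pCons (synth a k (Suc (Suc n)))
          ([:- a k, 1:] * synth_poly a (Suc k) n + [:synth a (Suc k) (Suc n):])"
    by (simp only: synth_poly.simps(2)[of a k "Suc n"] Suc)
  also have "\<dots> = [:- a k, 1:] * synth_poly a (Suc k) (Suc n) + [:synth a (Suc k) (Suc (Suc n)):]"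
    by (simp add: algebra_simps)
  finally show ?case .
qed

lemma synth_poly_eq_prod:
  assumes "\<And>k. k < n \<Longrightarrow> synth a (Suc k) (n - k) = 0"
  shows "synth_poly a 0 n = (\<Prod>i<n. [:- a i, 1:])"
proof -
  have "synth_poly a 0 n = (\<Prod>i<k. [:- a i, 1:]) * synth_poly a k (n - k)" if "k \<le> n" for k
    using that
  proof (induction k)
    case (Suc k)
    then have "n - k = Suc (n - Suc k)" by simp
    then have "synth_poly a k (n - k) = [:- a k, 1:] * synth_poly a (Suc k) (n - Suc k)"
      using synth_poly_division[of a k "n - Suc k"] assms[of k] Suc.prems by simp
    then show ?case using Suc by (simp add: mult_ac del: mult_pCons_left)
  qed simp
  from this[of n] show ?thesis by simp
qed

lemma synth_poly_0: "synth_poly a 0 n = monom 1 n + (\<Sum>m=1..n. monom (a (m - 1)) (n - m))"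
proof (induction n)
  case (Suc n)
  have "pCons c p = monom c 0 + monom 1 1 * p" for c :: complex and p
    by (simp add: monom_0 monom_Suc one_pCons)
  then have "synth_poly a 0 (Suc n) = monom (a n) 0 + monom 1 1 * synth_poly a 0 n"
    by simp
  also have "monom 1 1 * synth_poly a 0 n
      = monom 1 (Suc n) + (\<Sum>m=1..n. monom (a (m - 1)) (Suc n - m))"
    unfolding Suc
    by (auto simp: distrib_left sum_distrib_left mult_monom Suc_diff_le intro!: sum.cong)
  finally show ?case by (simp add: add_ac)
qed simp

lemma ulam_polynomial_synth:
  assumes "synth_poly a 0 d = (\<Prod>i<d. [:- a i, 1:])" "d \<ge> 1"
  shows "ulam_polynomial d (synth_poly a 0 d)"
proof -
  \<comment> \<open>Roots are counted from 0 here but from 1 in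
    \<open>ulam_polynomial\<close>.\<close>
  have "(\<Prod>i<d. [:- a i, 1:]) = (\<Prod>n=1..d. [:- a (n - 1), 1:])"
    by (rule prod.reindex_bij_witness[of _ "\<lambda>n. n - 1" Suc]) auto
  then show ?thesis
    unfolding ulam_polynomial_def using assms(2)
    by (intro conjI exI[of _ "\<lambda>n. a (n - 1)"] synth_poly_0) (simp_all add: assms(1))
qed

lemma coeff_synth_poly:
  assumes "m \<in> {1..d}"
  shows "coeff (synth_poly a 0 d) (d - m) = a (m - 1)"
proof -
  have "coeff (synth_poly a 0 d) (d - m)
      = (if d = d - m then 1 else 0) + (\<Sum>k=1..d. if d - k = d - m then a (k - 1) else 0)"
    by (simp add: synth_poly_0 coeff_sum cong: if_cong)
  also have "(\<Sum>k=1..d. if d - k = d - m then a (k - 1) else 0)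
      = (\<Sum>k=1..d. if k = m then a (k - 1) else 0)"
    using assms by (intro sum.cong) auto
  finally show ?thesis
    using assms by auto
qed

text \<open>Within these bounds \<open>synth x k i\<close> is a polynomial expression in
  \<open>x 0\<close>, ..., \<open>x (n - 1)\<close>.\<close>

lemma synth_cong_ideal:
  assumes J: "is_ideal J" and xy: "\<And>i. i < n \<Longrightarrow> x i - y i \<in> J" and "k \<le> n" "i \<le> n"
  shows "synth x k i - synth y k i \<in> J"
  using assms(3,4)
proof (induction k arbitrary: i)
  case 0
  then show ?case by (cases i) (simp_all add: ideal_zero[OF J] xy)
next
  case (Suc k)
  from Suc.prems(2) show ?case
  proof (induction i)
    case (Suc i)
    let ?x = "synth x (Suc k) i" and ?y = "synth y (Suc k) i"
    have "synth x (Suc k) (Suc i) - synth y (Suc k) (Suc i)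
        = (synth x k (Suc i) - synth y k (Suc i)) + (x k * (?x - ?y) + ?y * (x k - y k))"
      by (simp add: algebra_simps)
    also have "\<dots> \<in> J"
      using Suc Suc.prems \<open>Suc k \<le> n\<close> Suc.IH
      by (intro ideal_add[OF J] ideal_mult[OF J] xy \<open>\<And>i. k \<le> n \<Longrightarrow> i \<le> n \<Longrightarrow> synth x k i - synth y k i \<in> J\<close>) simp_all
    finally show ?case .
  qed (simp add: ideal_zero[OF J])
qed

lemma synth_const: "synth (\<lambda>i. const (a i)) k i = const (synth a k i)"
  by (induction a k i rule: synth.induct) (simp_all add: single_add mult_single)

section \<open>The generic Ulam equations\<close>

text \<open>In the recursion the first summand has weight at most that of the \<open>i\<close>-th
  power of the preceding variable, hence less than the new power. At the start, \<open>var i\<close>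
  weighs \<open>i + 2\<close>, less than the weight \<open>2 * (i + 1)\<close> of the power of
  \<open>var 0\<close> if \<open>i > 0\<close>.\<close>

lemma leads_synth_var: "leads (\<lambda>k. k + 2) (single k i) (synth var (Suc k) i)"
proof (induction k arbitrary: i)
  case 0
  show ?case
  proof (induction i)
    case 0
    show ?case by (simp add: leads_def)
  next
    case (Suc i)
    have lead: "leads (\<lambda>k. k + 2) (single 0 (Suc i)) (var 0 * synth var (Suc 0) i)"
      using leads_mon_mult[OF Suc, of "single 0 1"] by (simp add: single_add[symmetric])
    show ?case
    \<comment> \<open>For \<open>i = 0\<close> both summands are \<open>var 0\<close>, and the
      leading coefficient becomes 2.\<close>
    proof (cases "i = 0")
      case True
      have "var 0 + var 0 = single (single 0 1) 2"
        by (simp only: single_add[symmetric] one_add_one)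
      with True show ?thesis by (simp add: leads_def)
    next
      case False
      then show ?thesis using leads_add[OF lead, of "var i"] by simp
    qed
  qed
next
  case (Suc k)
  show ?case
  proof (induction i)
    case 0
    show ?case by (simp add: leads_def)
  next
    case IH: (Suc i)
    have lead: "leads (\<lambda>k. k + 2) (single (Suc k) (Suc i)) (var (Suc k) * synth var (Suc (Suc k)) i)"
      using leads_mon_mult[OF IH, of "single (Suc k) 1"] by (simp add: single_add[symmetric])
    have "weight (\<lambda>k. k + 2) n < weight (\<lambda>k. k + 2) (single (Suc k) (Suc i))"
      if "n \<in> keys (synth var (Suc k) (Suc i))" for n
      using leads_weight_le[OF Suc that] by simp
    from leads_add[OF lead this] show ?case by simp
  qed
qed

text \<open>The ring has infinitely many variables; those with \<open>k \<ge> N\<close> are generators, hence zero in the quotient.\<close>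
definition remainder :: "nat \<Rightarrow> nat \<Rightarrow> mpoly" where
  "remainder N k = (if k < N then synth var (Suc k) (N - k) else var k)"

lemma synth_one: "synth x k 1 = x 0 + (\<Sum>i<k. x i)"
  by (induction k) (simp_all add: algebra_simps)

context
  fixes N :: nat
begin

interpretation pure_powers "\<lambda>k. k + 2" "\<lambda>k. if k < N then N - k else 1" "remainder N"
proof
  fix k
  show "leads (\<lambda>k. k + 2) (single k (if k < N then N - k else 1)) (remainder N k)"
    using leads_synth_var[of k "N - k"] by (auto simp: remainder_def leads_def)
qed

lemma is_ideal_I: "is_ideal I"
  unfolding is_ideal_def using I_add I_mult vs.span_zero by (auto simp: I_def)

lemma last_var_notin_I:
  assumes "N \<ge> 2"
  shows "var (N - 1) \<notin> I"
proof
  assume "var (N - 1) \<in> I"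
  then have "remainder N (N - 1) - var (N - 1) \<in> I"
    using ideal_diff[OF is_ideal_I f_in_I] by blast
  moreover obtain M where M: "N = Suc (Suc M)"
    using assms by (metis add_2_eq_Suc le_Suc_ex)
  ultimately have I: "var 0 + (\<Sum>i\<le>M. var i) \<in> I" (is "?p \<in> I")
    using synth_one[of var N]
    by (simp add: remainder_def lessThan_Suc_atMost del: synth.simps)
  have "lookup (var i) (single 0 1) = (if i = 0 then 1 else 0)" for i
    by (simp add: lookup_single when_def)
       (metis One_nat_def keys_single singleton_inject zero_neq_one)
  then have "lookup ?p (single 0 1) = 2"
    by (simp add: lookup_add lookup_sum)
  then have "?p \<noteq> 0" by auto
  moreover have "keys ?p \<subseteq> reduced"
  proof
    fix m assume "m \<in> keys ?p"
    then have "\<exists>i\<le>M. m = single i 1"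
      using keys_add[of "var 0" "\<Sum>i\<le>M. var i"] keys_sum[of var "{..M}"] by fastforce
    \<comment> \<open>For \<open>i \<le> M\<close> the exponent bound \<open>N - i\<close> is at
      least 2, so \<open>var i\<close> is reduced.\<close>
    then show "m \<in> reduced"
      unfolding reduced_def using M by (auto simp: lookup_single when_def)
  qed
  ultimately show False
    using keys_not_subset_reduced[OF I] by blast
qed

text \<open>\<open>synth var k (N - k)\<close> is the constant term of the \<open>k\<close>-th
  quotient; up to the remainder, each division by \<open>X - var k\<close> splits off a factor
  \<open>- var k\<close> from it.\<close>

lemma last_var_cong_prod:
  assumes "k \<le> N"
  shows "synth var 0 N - (\<Prod>i<k. - var i) * synth var k (N - k) \<in> I"
  using assms
proof (induction k)
  case 0
  show ?case using ideal_zero[OF is_ideal_I] by simp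
next
  case (Suc k)
  then have N: "N - k = Suc (N - Suc k)" by simp
  have "synth var 0 N - (\<Prod>i<Suc k. - var i) * synth var (Suc k) (N - Suc k)
      = (synth var 0 N - (\<Prod>i<k. - var i) * synth var k (N - k))
        + (\<Prod>i<k. - var i) * remainder N k"
    using Suc.prems by (simp add: remainder_def N algebra_simps)
  also have "\<dots> \<in> I"
    using Suc by (intro ideal_add[OF is_ideal_I] I_mult f_in_I) simp
  finally show ?case .
qed

lemma ulam_solution_exists:
  assumes "N \<ge> 2"
  shows "\<exists>a. (\<forall>k<N. synth a (Suc k) (N - k) = (0 :: complex)) \<and> (\<forall>i<N - 1. a i \<noteq> 0)"
proof -
  define J where "J = {p. p * var (N - 1) \<in> I}"
  have J: "is_ideal J"
    using is_ideal_I unfolding is_ideal_def J_def by (auto simp: distrib_right mult.assoc)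
  have "1 \<notin> J"
    using last_var_notin_I[OF assms] by (simp add: J_def)
  have "I \<subseteq> J"
    using I_mult by (auto simp: J_def mult.commute)
  have "finite (mon ` reduced)"
    by (intro finite_imageI finite_reduced[of N]) simp
  moreover have "p \<in> vs.span (mon ` reduced \<union> J)" for p
    using in_span_reduced[of p] vs.span_mono[of "mon ` reduced \<union> I" "mon ` reduced \<union> J"] \<open>I \<subseteq> J\<close>
    by blast
  ultimately obtain a J' where J': "is_ideal J'" "1 \<notin> J'" "J \<subseteq> J'"
      and a: "\<And>i. i < N \<Longrightarrow> var i - const (a i) \<in> J'"
    using proper_ideal_point[OF J \<open>1 \<notin> J\<close>, of _ N] by meson
  show ?thesis
  proof (intro exI conjI allI impI)
    \<comment> \<open>Modulo \<open>J'\<close> the remainder equals its value at \<open>a\<close>,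
      and a proper ideal contains no nonzero constant.\<close>
    fix k assume k: "k < N"
    then have "synth var (Suc k) (N - k) \<in> J'"
      using f_in_I[of k] \<open>I \<subseteq> J\<close> J'(3) by (auto simp: remainder_def)
    moreover have "synth var (Suc k) (N - k) - synth (\<lambda>i. const (a i)) (Suc k) (N - k) \<in> J'"
      using k by (intro synth_cong_ideal[OF J'(1) a]) auto
    ultimately have "synth (\<lambda>i. const (a i)) (Suc k) (N - k) \<in> J'"
      using ideal_diff[OF J'(1)] by fastforce
    then show "synth a (Suc k) (N - k) = 0"
      using const_in_ideal_imp_zero[OF J'(1,2)] by (simp only: synth_const)
  next
    fix i assume i: "i < N - 1"
    obtain M where M: "N = Suc M"
      using assms by (cases N) auto
    \<comment> \<open>The congruence after all \<open>N\<close> divisions, with the factor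
      \<open>var M\<close> taken out, puts the cofactor into the ideal quotient
      \<open>J\<close>.\<close>
    have "(1 + (\<Prod>i<M. - var i)) * var M = synth var 0 N - (\<Prod>i<N. - var i) * synth var N (N - N)"
      by (simp add: M algebra_simps)
    also have "\<dots> \<in> I" by (intro last_var_cong_prod) simp
    finally have "1 + (\<Prod>i<M. - var i) \<in> J'"
      using J'(3) by (auto simp: J_def M)
    show "a i \<noteq> 0"
    \<comment> \<open>A zero value would put \<open>var i\<close>, hence the product, and hence 1
      into \<open>J'\<close>.\<close>
    proof
      assume "a i = 0"
      then have "var i \<in> J'" using a[of i] i by simp
      moreover have "(\<Prod>i<M. - var i) = - (\<Prod>i\<in>{..<M} - {i}. - var i) * var i"
        using i by (simp add: M prod.remove[of "{..<M}" i])
      ultimately have "(\<Prod>i<M. - var i) \<in> J'"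
        using ideal_mult[OF J'(1)] by metis
      then show False
        using ideal_diff[OF J'(1) \<open>1 + (\<Prod>i<M. - var i) \<in> J'\<close>] J'(2) by fastforce
    qed
  qed
qed

end

theorem theorem3p9:
  fixes N :: nat
  assumes "N \<ge> 2"
  shows "\<exists>d p. (d = N \<or> d = N - 1) \<and> ulam_polynomial d p \<and>
           (\<forall>m\<in>{1..d}. coeff p (d - m) \<noteq> 0)"
proof -
  obtain a :: "nat \<Rightarrow> complex"
    where a: "\<And>k. k < N \<Longrightarrow> synth a (Suc k) (N - k) = 0" "\<And>i. i < N - 1 \<Longrightarrow> a i \<noteq> 0"
    using ulam_solution_exists[OF assms] by blast
  have prod: "synth_poly a 0 N = (\<Prod>i<N. [:- a i, 1:])"
    by (rule synth_poly_eq_prod) (rule a(1))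
  have ulam: ?thesis
    if "d = N \<or> d = N - 1" "synth_poly a 0 d = (\<Prod>i<d. [:- a i, 1:])" "\<And>i. i < d \<Longrightarrow> a i \<noteq> 0" for d
  proof (intro exI conjI ballI)
    show "ulam_polynomial d (synth_poly a 0 d)"
      using that(1) assms by (intro ulam_polynomial_synth[OF that(2)]) auto
    fix m assume m: "m \<in> {1..d}"
    then have "m - 1 < d" by auto
    then show "coeff (synth_poly a 0 d) (d - m) \<noteq> 0"
      using coeff_synth_poly[OF m] that(3) by simp
  qed (rule that(1))
  obtain M where M: "N = Suc M"
    using assms by (cases N) auto
  show ?thesis
  proof (cases "a M = 0")
    case True
    \<comment> \<open>\<open>a M\<close> is both the constant coefficient and the last root, so when
      it vanishes a factor \<open>X\<close> cancels on both sides.\<close>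
    have "pCons 0 (synth_poly a 0 M) = (\<Prod>i<M. [:- a i, 1:]) * [:0, 1:]"
      using prod unfolding M prod.lessThan_Suc synth_poly.simps synth.simps True by simp
    also have "\<dots> = pCons 0 (\<Prod>i<M. [:- a i, 1:])"
      by (simp only: mult.commute[of _ "[:0, 1:]"] mult_pCons_left) simp
    finally have "synth_poly a 0 M = (\<Prod>i<M. [:- a i, 1:])"
      by simp
    then show ?thesis
      by (rule ulam[rotated]) (simp_all add: a(2) M)
  next
    case False
    have "a i \<noteq> 0" if "i < N" for i
      using a(2)[of i] False that by (cases "i = M") (auto simp: M)
    with prod show ?thesis
      by (intro ulam[of N]) simp_all
  qed
qed

end
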